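(* Let $\lambda,\kappa\in\mathbb{R}_+$, and consider the optimization problem $$(P)\qquad \min\{f(x)\ |\ g(x)\leq 0,\ \|x\|_1\leq\lambda,\ x\in\mathbb{R}^n\},$$ where $f$ and the components $g_i$ of $g$ are Lipschitz in the sense that $|f(x)-f(y)|\leq\kappa\|x-y\|_\infty$ and $|g_i(x)-g_i(y)|\leq\kappa\|x-y\|_\infty$ for all $i$. If $\epsilon>0$ and an optimal $x^*$ exists for $(P)$, then Algorithm 3 (described in the context) is an additive PTAS for $(P)$ with oracle time complexity $$O\big(n^{((2+\delta)\lfloor\lambda\kappa/\epsilon\rfloor)^2/2+1}\big)$$ for any $\delta\in(0,1)$.
   Context: Additive PTAS: let $x^*$ be any minimizer of $(P)$. An additive PTAS (polynomial time approximation scheme) for $(P)$ is an algorithm that, for fixed $\epsilon>0$, requires a polynomial in $n$ number of oracle operations to compute a solution $\hat{x}$ such that $f(\hat{x})-f(x^* )\leq\epsilon$, $g(\hat{x})\leq\epsilon$ (componentwise), $\|\hat{x}\|_1\leq\lambda$, and $\hat{x}\in\mathbb{R}^n$. Computing $f,g$ comprises a single oracle step, and $\lambda,\kappa$ are treated as fixed parameters. Notation: $\mathbb{N}=\{0,1,2,\ldots\}$, $[r]=\{1,\ldots,r\}$, $\|x\|_1=\sum_j|x_j|$, $\|x\|_\infty=\max_j|x_j|$, $\lfloor r\rfloor$ is the floor of $r$, $\circ$ is the elementwise (Hadamard) product, and $\mathbf{1}(A)$ is $1$ if $A$ is true and $0$ otherwise. $M_k^N$ denotes the set of vectors $u\in[N]^k$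 with $u_i\leq u_{i+1}$ for all $i\in[k-1]$ (i.e. the $k$-multisets of $[N]$, written in nondecreasing order). The map $\varphi:M_k^N\to\mathbb{N}^k$ is given by $(\varphi(u))_1=u_1-1$ and $(\varphi(u))_i=u_i-u_{i-1}$ for $i\in\{2,\ldots,k\}$. For a binary vector $b\in\{0,1\}^n$, $\mathrm{SignPerm}(b)$ is the set of all sign ($+/-$) permutations of the nonzero entries of $b$, i.e. all vectors $s$ with $s_i\in\{-1,+1\}$ if $b_i=1$ and $s_i=0$ if $b_i=0$. Algorithm 3: Set $f^*:=+\infty$. For all $u\in M_n^{\lfloor\lambda\kappa/\epsilon\rfloor+1}$: set $v:=\varphi(u)$; for all $i\in[n]$ set $b_i:=\mathbf{1}(v_i\neq 0)$; for all $s\in\mathrm{SignPerm}(b)$: set $x:=(\epsilon/\kappa)\cdot(v\circ s)$, and if $f(x)<f^*$ and $g(x)\leq\epsilon$, set $x^*:=x$ and $f^*:=f(x)$. The returned solution $\hat{x}$ is the final value of the variable $x^*$ of the algorithm. Cost conventions: the elements of $M_k^N$ can each be generated in $O(1)$ oracle time, and the elements of $\mathrm{SignPerm}(b)$ can each be generated in $O(1)$ oracle time (by standard combinatorial generation algorithms); a single scalar arithmetic operation on vector entries costs one step. *)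

theory Defs
  imports
    Complex_Main
    "HOL-Library.Extended_Real"
    "HOL-Library.Landau_Symbols"
    "HOL-Computational_Algebra.Polynomial"
    "Jordan_Normal_Form.Matrix"
begin

section \<open>The optimization problem\<close>

text \<open>Coordinates are numbered from 0, so the index set \<open>[n]\<close> becomes \<open>{..<n}\<close>.  The order on
  vectors is the componentwise one of \<^theory>\<open>Jordan_Normal_Form.Matrix\<close>.\<close>

definition l1_norm :: "real vec \<Rightarrow> real" where
  "l1_norm x = (\<Sum>j<dim_vec x. \<bar>x $ j\<bar>)"

text \<open>Only used in dimension at least 1, where the maximum is over a nonempty set.\<close>

definition linf_norm :: "real vec \<Rightarrow> real" where
  "linf_norm x = Max ((\<lambda>j. \<bar>x $ j\<bar>) ` {..<dim_vec x})"

text \<open>\<open>n\<close> is the number of variables, \<open>m\<close> the number of components of \<open>g\<close>.\<close>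

definition lipschitz_problem ::
    "real \<Rightarrow> nat \<Rightarrow> nat \<Rightarrow> (real vec \<Rightarrow> real) \<Rightarrow> (real vec \<Rightarrow> real vec) \<Rightarrow> bool" where
  "lipschitz_problem \<kappa> n m f g \<longleftrightarrow>
     n \<ge> 1 \<and> g \<in> carrier_vec n \<rightarrow> carrier_vec m \<and>
     (\<forall>x\<in>carrier_vec n. \<forall>y\<in>carrier_vec n.
        \<bar>f x - f y\<bar> \<le> \<kappa> * linf_norm (x - y) \<and>
        (\<forall>i<m. \<bar>g x $ i - g y $ i\<bar> \<le> \<kappa> * linf_norm (x - y)))"

definition feasible_set :: "real \<Rightarrow> nat \<Rightarrow> nat \<Rightarrow> (real vec \<Rightarrow> real vec) \<Rightarrow> real vec set" where
  "feasible_set lam n m g = {x \<in> carrier_vec n. g x \<le> 0\<^sub>v m \<and> l1_norm x \<le> lam}"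

definition is_minimizer ::
    "real \<Rightarrow> nat \<Rightarrow> nat \<Rightarrow> (real vec \<Rightarrow> real) \<Rightarrow> (real vec \<Rightarrow> real vec) \<Rightarrow> real vec \<Rightarrow> bool" where
  "is_minimizer lam n m f g x \<longleftrightarrow>
     x \<in> feasible_set lam n m g \<and> (\<forall>y\<in>feasible_set lam n m g. f x \<le> f y)"

definition const_vec :: "nat \<Rightarrow> real \<Rightarrow> real vec" where
  "const_vec m a = vec m (\<lambda>_. a)"


section \<open>Step-counting computations\<close>

text \<open>A computation is its result paired with the number of steps it used.\<close>

type_synonym 'a counted = "'a \<times> nat"

definition charge :: "nat \<Rightarrow> 'a \<Rightarrow> 'a counted" where
  "charge t a = (a, t)"

definition bind_counted :: "'a counted \<Rightarrow> ('a \<Rightarrow> 'b counted) \<Rightarrow> 'b counted" (infixl "\<triangleright>" 54) where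
  "p \<triangleright> q = (fst (q (fst p)), snd p + snd (q (fst p)))"

primrec for_each :: "'a list \<Rightarrow> ('a \<Rightarrow> 's \<Rightarrow> 's counted) \<Rightarrow> 's \<Rightarrow> 's counted" where
  "for_each [] body st = charge 0 st"
| "for_each (a # as) body st = body a st \<triangleright> (\<lambda>st'. for_each as body st')"

text \<open>Builds a vector entry by entry, adding up the costs of the entries.\<close>

definition build_vec :: "nat \<Rightarrow> (nat \<Rightarrow> 'a counted) \<Rightarrow> 'a vec counted" where
  "build_vec n h = (vec n (\<lambda>i. fst (h i)), \<Sum>i<n. snd (h i))"


section \<open>The algorithm\<close>

text \<open>The nondecreasing vectors in \<open>[N]\<^sup>k\<close>.\<close>

definition multisets :: "nat \<Rightarrow> nat \<Rightarrow> nat vec set" where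
  "multisets k N = {u \<in> carrier_vec k. (\<forall>i<k. u $ i \<in> {1..N}) \<and> (\<forall>i. Suc i < k \<longrightarrow> u $ i \<le> u $ Suc i)}"

definition SignPerm :: "nat vec \<Rightarrow> int vec set" where
  "SignPerm b = {s \<in> carrier_vec (dim_vec b).
     \<forall>i<dim_vec b. (b $ i = 1 \<longrightarrow> s $ i \<in> {-1, 1}) \<and> (b $ i = 0 \<longrightarrow> s $ i = 0)}"

definition enumerates :: "'a list \<Rightarrow> 'a set \<Rightarrow> bool" where
  "enumerates as A \<longleftrightarrow> distinct as \<and> set as = A"

text \<open>The truncated subtractions are exact on \<^const>\<open>multisets\<close>.  Each entry takes one subtraction.\<close>

definition \<phi>_counted :: "nat \<Rightarrow> nat vec \<Rightarrow> nat vec counted" where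
  "\<phi>_counted n u =
     build_vec n (\<lambda>i. charge 1 (if i = 0 then u $ 0 - 1 else u $ i - u $ (i - 1)))"

definition support_counted :: "nat \<Rightarrow> nat vec \<Rightarrow> nat vec counted" where
  "support_counted n v = build_vec n (\<lambda>i. charge 1 (if v $ i \<noteq> 0 then 1 else 0))"

text \<open>The vector \<open>h \<cdot> (v \<circ> s)\<close>, with \<open>\<circ>\<close> the elementwise product: two multiplications per entry.\<close>

definition grid_point_counted :: "nat \<Rightarrow> real \<Rightarrow> nat vec \<Rightarrow> int vec \<Rightarrow> real vec counted" where
  "grid_point_counted n h v s =
     build_vec n (\<lambda>i. charge 2 (h * (real (v $ i) * real_of_int (s $ i))))"

text \<open>The state holds the current \<open>x\<^sup>*\<close> (\<^const>\<open>None\<close> until it is first set) and \<open>f\<^sup>*\<close>.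

  One oracle step yields both \<open>f x\<close> and \<open>g x\<close>, including the outcome of the componentwise test of
  \<open>g x\<close> against \<open>\<epsilon>\<close>; step counts therefore do not depend on \<open>m\<close>.  The scalar comparison
  \<open>f x < f\<^sup>*\<close> is one further step, and so is each scalar copied in an update of \<open>x\<^sup>*\<close> and \<open>f\<^sup>*\<close>.\<close>

definition try_point_counted ::
    "real \<Rightarrow> nat \<Rightarrow> nat \<Rightarrow> (real vec \<Rightarrow> real) \<Rightarrow> (real vec \<Rightarrow> real vec) \<Rightarrow> real vec
      \<Rightarrow> real vec option \<times> ereal \<Rightarrow> (real vec option \<times> ereal) counted" where
  "try_point_counted \<epsilon> n m f g x st =
     charge 1 (f x, g x \<le> const_vec m \<epsilon>) \<triangleright> (\<lambda>(fx, g_ok).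
     charge 1 (ereal fx < snd st) \<triangleright> (\<lambda>better.
     if better \<and> g_ok then charge (n + 1) (Some x, ereal fx) else charge 0 st))"

text \<open>The orders in which the two loops run are given by \<open>enumM k N\<close>, a list of the elements of
  \<^term>\<open>multisets k N\<close>, and \<open>enumS b\<close>, a list of the elements of \<^term>\<open>SignPerm b\<close>.  Generating the
  next element of either list costs \<open>c\<close> steps.  The initial charges pay for \<open>f\<^sup>* := \<infinity>\<close>,
  for \<open>\<epsilon> / \<kappa>\<close>, and for the four operations in \<open>\<lfloor>\<lambda> \<kappa> / \<epsilon>\<rfloor> + 1\<close>.\<close>

definition algorithm3 ::
    "(nat \<Rightarrow> nat \<Rightarrow> nat vec list) \<Rightarrow> (nat vec \<Rightarrow> int vec list) \<Rightarrow> nat \<Rightarrow> real \<Rightarrow> real \<Rightarrow> real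
      \<Rightarrow> nat \<Rightarrow> nat \<Rightarrow> (real vec \<Rightarrow> real) \<Rightarrow> (real vec \<Rightarrow> real vec) \<Rightarrow> real vec option counted" where
  "algorithm3 enumM enumS c lam \<kappa> \<epsilon> n m f g =
     charge 1 (None, \<infinity>) \<triangleright> (\<lambda>st0.
     charge 1 (\<epsilon> / \<kappa>) \<triangleright> (\<lambda>h.
     charge 4 (nat \<lfloor>lam * \<kappa> / \<epsilon>\<rfloor> + 1) \<triangleright> (\<lambda>N.
     for_each (enumM n N) (\<lambda>u st.
       charge c () \<triangleright> (\<lambda>_.
       \<phi>_counted n u \<triangleright> (\<lambda>v.
       support_counted n v \<triangleright> (\<lambda>b.
       for_each (enumS b) (\<lambda>s st'.
         charge c () \<triangleright> (\<lambda>_.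
         grid_point_counted n h v s \<triangleright> (\<lambda>x.
         try_point_counted \<epsilon> n m f g x st')))
       st)))) st0 \<triangleright> (\<lambda>st.
     charge 0 (fst st)))))"


section \<open>Approximation schemes\<close>

text \<open>An algorithm takes \<open>\<epsilon>\<close>, the sizes \<open>n\<close> and \<open>m\<close> and the oracles for \<open>f\<close> and \<open>g\<close>; \<open>lam\<close> and
  \<open>\<kappa>\<close> are fixed beforehand, so step bounds may depend on \<open>lam\<close>, \<open>\<kappa>\<close> and \<open>\<epsilon>\<close>, but not on \<open>f\<close>,
  \<open>g\<close> or \<open>m\<close>.\<close>

type_synonym algo = "real \<Rightarrow> nat \<Rightarrow> nat \<Rightarrow> (real vec \<Rightarrow> real) \<Rightarrow> (real vec \<Rightarrow> real vec)
  \<Rightarrow> real vec option counted"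

definition additive_PTAS :: "real \<Rightarrow> real \<Rightarrow> algo \<Rightarrow> bool" where
  "additive_PTAS lam \<kappa> A \<longleftrightarrow>
     (\<forall>\<epsilon>>0. \<exists>p :: nat poly. \<forall>n m f g xstar.
        lipschitz_problem \<kappa> n m f g \<and> is_minimizer lam n m f g xstar \<longrightarrow>
          (\<exists>xhat. fst (A \<epsilon> n m f g) = Some xhat \<and>
             f xhat - f xstar \<le> \<epsilon> \<and> g xhat \<le> const_vec m \<epsilon> \<and>
             l1_norm xhat \<le> lam \<and> xhat \<in> carrier_vec n) \<and>
          snd (A \<epsilon> n m f g) \<le> poly p n)"

definition oracle_time_bigo :: "real \<Rightarrow> real \<Rightarrow> algo \<Rightarrow> real \<Rightarrow> (nat \<Rightarrow> real) \<Rightarrow> bool" where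
  "oracle_time_bigo lam \<kappa> A \<epsilon> h \<longleftrightarrow>
     (\<exists>T :: nat \<Rightarrow> nat. (\<lambda>n. real (T n)) \<in> O(h) \<and>
        (\<forall>n m f g xstar. lipschitz_problem \<kappa> n m f g \<and> is_minimizer lam n m f g xstar \<longrightarrow>
           snd (A \<epsilon> n m f g) \<le> T n))"

end

theory Submission
  imports Defs
begin

text \<open>Write \<open>K = \<lfloor>lam * \<kappa> / \<epsilon>\<rfloor>\<close> and \<open>h = \<epsilon> / \<kappa>\<close>.  The differences of a nondecreasing vector with
  entries in \<open>{1..K + 1}\<close> form an arbitrary vector of naturals with entry sum at most \<open>K\<close>, so the
  algorithm inspects exactly the points of the grid \<open>h \<int>\<^sup>n\<close> whose 1-norm is at most \<open>h K\<close>.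

  For correctness, round each coordinate of a minimizer towards zero to a multiple of \<open>h\<close>.  This does
  not increase the 1-norm, hence ends at an inspected point (\<open>candidate_near\<close>), and it moves each
  coordinate by less than \<open>h\<close>.  By the Lipschitz condition \<open>f\<close> and the components of \<open>g\<close> grow
  by at most \<open>\<kappa> h = \<epsilon>\<close>.  The algorithm returns a point with the least value of \<open>f\<close> among the
  inspected points that pass the test on \<open>g\<close> (\<open>algorithm3_best_of_candidates\<close>), so it does at
  least as well as the rounded minimizer; and \<open>h K \<le> lam\<close> bounds its 1-norm.  If \<open>\<kappa> = 0\<close>, then
  \<open>f\<close> and \<open>g\<close> are constant and the only inspected point, the origin, is already optimal.

  For the running time, there are at most \<open>(n + 1)\<^sup>K\<close> nondecreasing vectors (\<open>card_multisets_le\<close>),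
  each giving at most \<open>2\<^sup>K\<close> sign patterns, because at most \<open>K\<close> of the differences are nonzero
  (\<open>card_SignPerm_le\<close>).  Each point costs \<open>O(n)\<close> steps.  The total is \<open>O(n\<^sup>K\<^sup>+\<^sup>1)\<close> for fixed \<open>K\<close>, and
  \<open>K + 1\<close> does not exceed the stated exponent, as \<open>K \<le> 2 K\<^sup>2\<close> for integers.\<close>

section \<open>Results and costs of loops\<close>

lemma fst_charge [simp]: "fst (charge t a) = a" and snd_charge [simp]: "snd (charge t a) = t"
  by (simp_all add: charge_def)

lemma fst_bind [simp]: "fst (p \<triangleright> q) = fst (q (fst p))"
  and snd_bind [simp]: "snd (p \<triangleright> q) = snd p + snd (q (fst p))"
  by (simp_all add: bind_counted_def)

lemma snd_for_each_le:
  assumes "\<And>a st. a \<in> set as \<Longrightarrow> snd (body a st) \<le> B"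
  shows "snd (for_each as body st) \<le> length as * B"
  using assms
proof (induction as arbitrary: st)
  case (Cons a as)
  have "snd (body a st) \<le> B" "snd (for_each as body (fst (body a st))) \<le> length as * B"
    using Cons by auto
  then show ?case by simp
qed simp

text \<open>The invariant relates the state to the set of points inspected so far, and \<open>F a\<close> is the set
  of points that round \<open>a\<close> inspects.  The conclusion has the form of the premise on a single round, so
  the rule applies first to the inner loop and then, with its result, to the outer loop.\<close>

lemma for_each_invariant:
  assumes "\<And>a P st. a \<in> set as \<Longrightarrow> I P st \<Longrightarrow> I (P \<union> F a) (fst (body a st))"
    and "I P st"
  shows "I (P \<union> (\<Union>a\<in>set as. F a)) (fst (for_each as body st))"
  using assms
proof (induction as arbitrary: P st)
  case (Cons a as)
  have "I (P \<union> F a) (fst (body a st))" using Cons.prems by simp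
  with Cons.IH[of "P \<union> F a"] Cons.prems(1)
  have "I (P \<union> F a \<union> (\<Union>a\<in>set as. F a)) (fst (for_each as body (fst (body a st))))"
    by simp
  then show ?case by (simp add: Un_assoc)
qed simp

section \<open>The grid points visited by the algorithm\<close>

definition increments :: "nat \<Rightarrow> nat vec \<Rightarrow> nat vec" where
  "increments n u = fst (\<phi>_counted n u)"

definition support_vec :: "nat \<Rightarrow> nat vec \<Rightarrow> nat vec" where
  "support_vec n v = fst (support_counted n v)"

definition grid_point :: "nat \<Rightarrow> real \<Rightarrow> nat vec \<Rightarrow> int vec \<Rightarrow> real vec" where
  "grid_point n h v s = fst (grid_point_counted n h v s)"

definition candidates :: "nat \<Rightarrow> nat \<Rightarrow> real \<Rightarrow> real vec set" where
  "candidates n N h =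
     (\<Union>u\<in>multisets n N. grid_point n h (increments n u) `
        SignPerm (support_vec n (increments n u)))"

lemma increments_vec:
  "increments n u = vec n (\<lambda>i. if i = 0 then u $ 0 - 1 else u $ i - u $ (i - 1))"
  by (simp add: increments_def \<phi>_counted_def build_vec_def)

lemma support_vec_vec: "support_vec n v = vec n (\<lambda>i. if v $ i \<noteq> 0 then 1 else 0)"
  by (rule eq_vecI) (simp_all add: support_vec_def support_counted_def build_vec_def)

lemma grid_point_vec:
  "grid_point n h v s = vec n (\<lambda>i. h * (real (v $ i) * real_of_int (s $ i)))"
  by (simp add: grid_point_def grid_point_counted_def build_vec_def)

lemma support_vec_binary: "set\<^sub>v (support_vec n v) \<subseteq> {0, 1}"
  by (auto simp: support_vec_vec vec_set_def)

lemma SignPerm_support_vec_iff: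
  "s \<in> SignPerm (support_vec n v) \<longleftrightarrow>
     s \<in> carrier_vec n \<and> (\<forall>i<n. if v $ i = 0 then s $ i = 0 else s $ i = 1 \<or> s $ i = - 1)"
  by (auto simp: SignPerm_def support_vec_vec)

text \<open>The differences telescope: together they add up to the last entry of \<open>u\<close> minus 1.\<close>

lemma sum_increments_le:
  assumes "u \<in> multisets n (Suc K)"
  shows "(\<Sum>i<n. increments n u $ i) \<le> K"
proof (cases n)
  case (Suc n')
  have "j < n \<Longrightarrow> Suc (\<Sum>i<Suc j. increments n u $ i) = u $ j" for j
  proof (induction j)
    case 0
    then have "u $ 0 \<ge> 1" using assms by (auto simp: multisets_def)
    then show ?case using 0 by (simp add: increments_vec)
  next
    case (Suc j)
    then have "u $ j \<le> u $ Suc j" using assms by (auto simp: multisets_def)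
    then show ?case using Suc by (simp add: increments_vec)
  qed
  from this[of n'] have "Suc (\<Sum>i<n. increments n u $ i) = u $ n'" using Suc by simp
  moreover have "u $ n' \<le> Suc K" using assms Suc by (auto simp: multisets_def)
  ultimately show ?thesis by simp
qed simp

text \<open>Conversely, partial sums undo taking differences.\<close>

lemma increments_surj:
  assumes "v \<in> carrier_vec n" and "(\<Sum>i<n. v $ i) \<le> K"
  shows "\<exists>u\<in>multisets n (Suc K). increments n u = v"
proof
  let ?u = "vec n (\<lambda>i. Suc (\<Sum>j<Suc i. v $ j))"
  have "(\<Sum>j<Suc i. v $ j) \<le> K" if "i < n" for i
  proof -
    have "(\<Sum>j<Suc i. v $ j) \<le> (\<Sum>j<n. v $ j)"
      using that by (intro sum_mono2) auto
    with assms show ?thesis by simp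
  qed
  then show "?u \<in> multisets n (Suc K)" by (auto simp: multisets_def)
  show "increments n ?u = v"
  proof (rule eq_vecI)
    fix i assume "i < dim_vec v"
    then show "increments n ?u $ i = v $ i"
      using assms by (cases i) (auto simp: increments_vec)
  qed (use assms in \<open>auto simp: increments_vec\<close>)
qed

text \<open>A nondecreasing vector is determined by its numbers of entries that are at most \<open>j\<close>, for
  \<open>j = 1, \<dots>, K\<close>; the threshold \<open>K + 1\<close> would always give \<open>n\<close>.  Each of these \<open>K\<close> numbers is one of
  the \<open>n + 1\<close> values \<open>0, \<dots>, n\<close>.\<close>

lemma card_multisets_le: "card (multisets n (Suc K)) \<le> (n + 1) ^ K"
proof -
  define cnt where "cnt u = (\<lambda>j\<in>{1..K}. card {i. i < n \<and> u $ i \<le> j})" for u :: "nat vec"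
  have mono: "u $ i \<le> u $ j"
    if "u \<in> multisets n (Suc K)" "i \<le> j" "j < n" for u :: "nat vec" and i j
    using that(2,3)
  proof (induction j rule: dec_induct)
    case (step k)
    then show ?case using that(1) by (fastforce simp: multisets_def)
  qed simp
  \<comment> \<open>By monotonicity the entries up to \<open>j\<close> form an initial segment, known from its length.\<close>
  have le_iff: "u $ i \<le> j \<longleftrightarrow> i < card {i. i < n \<and> u $ i \<le> j}"
    if u: "u \<in> multisets n (Suc K)" and i: "i < n" for u :: "nat vec" and i j
  proof
    assume "u $ i \<le> j"
    then have "{..i} \<subseteq> {i. i < n \<and> u $ i \<le> j}" using mono[OF u] i by (auto intro: order_trans)
    then have "card {..i} \<le> card {i. i < n \<and> u $ i \<le> j}" by (intro card_mono) auto
    then show "i < card {i. i < n \<and> u $ i \<le> j}" by simp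
  next
    assume less: "i < card {i. i < n \<and> u $ i \<le> j}"
    show "u $ i \<le> j"
    proof (rule ccontr)
      assume "\<not> u $ i \<le> j"
      then have "k < i" if "k < n" "u $ k \<le> j" for k
        using mono[OF u, of i k] that by (cases "i \<le> k") auto
      then have "{i. i < n \<and> u $ i \<le> j} \<subseteq> {..<i}" by auto
      then have "card {i. i < n \<and> u $ i \<le> j} \<le> card {..<i}" by (intro card_mono) auto
      with less show False by simp
    qed
  qed
  have "inj_on cnt (multisets n (Suc K))"
  proof (rule inj_onI)
    fix u w assume u: "u \<in> multisets n (Suc K)" and w: "w \<in> multisets n (Suc K)"
      and eq: "cnt u = cnt w"
    show "u = w"
    proof (rule eq_vecI)
      fix i assume "i < dim_vec w"
      then have i: "i < n" using w by (auto simp: multisets_def)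
      have range: "u $ i \<in> {1..Suc K}" "w $ i \<in> {1..Suc K}"
        using u w i by (auto simp: multisets_def)
      have iff: "u $ i \<le> j \<longleftrightarrow> w $ i \<le> j" if "j \<in> {1..K}" for j
        using le_iff[OF u i, of j] le_iff[OF w i, of j] fun_cong[OF eq, of j] that
        by (simp add: cnt_def)
      show "u $ i = w $ i"
        using iff[of "u $ i"] iff[of "w $ i"] range by (cases "u $ i \<le> K"; cases "w $ i \<le> K") auto
    qed (use u w in \<open>auto simp: multisets_def\<close>)
  qed
  moreover have "cnt ` multisets n (Suc K) \<subseteq> {1..K} \<rightarrow>\<^sub>E {..n}"
  proof (clarsimp simp: cnt_def)
    fix u :: "nat vec" and j
    have "card {i. i < n \<and> u $ i \<le> j} \<le> card {..<n}" by (intro card_mono) auto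
    then show "card {i. i < n \<and> u $ i \<le> j} \<le> n" by simp
  qed
  ultimately have "card (multisets n (Suc K)) \<le> card ({1..K} \<rightarrow>\<^sub>E {..n})"
    by (intro card_inj_on_le[of cnt]) (auto intro: finite_PiE)
  then show ?thesis by (simp add: card_PiE)
qed

text \<open>A sign pattern is determined by the set of its positive positions, a subset of the support of
  \<open>v\<close>; and the support has at most \<open>K\<close> elements because each contributes at least 1 to the sum.\<close>

lemma card_SignPerm_le:
  assumes "(\<Sum>i<n. v $ i) \<le> K"
  shows "card (SignPerm (support_vec n v)) \<le> 2 ^ K"
proof -
  let ?supp = "{i. i < n \<and> v $ i \<noteq> 0}"
  let ?pos = "\<lambda>s :: int vec. {i. i < n \<and> s $ i = 1}"
  have "inj_on ?pos (SignPerm (support_vec n v))"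
  proof (rule inj_onI)
    fix s t assume st: "s \<in> SignPerm (support_vec n v)" "t \<in> SignPerm (support_vec n v)"
      and "?pos s = ?pos t"
    then have iff: "s $ i = 1 \<longleftrightarrow> t $ i = 1" if "i < n" for i using that by auto
    show "s = t"
    proof (rule eq_vecI)
      fix i assume "i < dim_vec t"
      then have "i < n" using st by (auto simp: SignPerm_support_vec_iff)
      with st iff[of i] show "s $ i = t $ i"
        by (cases "v $ i = 0") (fastforce simp: SignPerm_support_vec_iff)+
    qed (use st in \<open>auto simp: SignPerm_support_vec_iff\<close>)
  qed
  moreover have "?pos ` SignPerm (support_vec n v) \<subseteq> Pow ?supp"
  proof (rule image_subsetI)
    fix s assume "s \<in> SignPerm (support_vec n v)"
    then have "v $ i \<noteq> 0" if "i < n" "s $ i = 1" for i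
      using that by (metis SignPerm_support_vec_iff zero_neq_one)
    then show "?pos s \<in> Pow ?supp" by blast
  qed
  ultimately have "card (SignPerm (support_vec n v)) \<le> card (Pow ?supp)"
    by (intro card_inj_on_le) auto
  also have "\<dots> = 2 ^ card ?supp" by (simp add: card_Pow)
  also have "card ?supp \<le> K"
  proof -
    have "card ?supp = (\<Sum>i\<in>?supp. 1)" by simp
    also have "\<dots> \<le> (\<Sum>i\<in>?supp. v $ i)" by (intro sum_mono) auto
    also have "\<dots> \<le> (\<Sum>i<n. v $ i)" by (intro sum_mono2) auto
    finally show ?thesis using assms by simp
  qed
  finally show ?thesis by (simp add: power_increasing)
qed

lemma l1_norm_candidate_le:
  assumes "x \<in> candidates n (Suc K) h" and "h \<ge> 0"
  shows "l1_norm x \<le> h * real K"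
proof -
  from assms(1) obtain u s where u: "u \<in> multisets n (Suc K)"
    and s: "s \<in> SignPerm (support_vec n (increments n u))"
    and x: "x = grid_point n h (increments n u) s"
    by (auto simp: candidates_def)
  let ?v = "increments n u"
  have "\<bar>x $ i\<bar> = h * real (?v $ i)" if "i < n" for i
    using s that assms(2)
    by (cases "?v $ i = 0") (fastforce simp: x grid_point_vec SignPerm_support_vec_iff)+
  then have "l1_norm x = (\<Sum>i<n. h * real (?v $ i))"
    by (simp add: l1_norm_def x grid_point_vec)
  also have "\<dots> = h * real (\<Sum>i<n. ?v $ i)" by (simp add: sum_distrib_left)
  also have "\<dots> \<le> h * real K"
    using sum_increments_le[OF u] assms(2) by (intro mult_left_mono of_nat_mono)
  finally show ?thesis .
qed

lemma candidates_dim: "candidates n N h \<subseteq> carrier_vec n"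
  by (auto simp: candidates_def grid_point_vec)

text \<open>This serves the case \<open>\<kappa> = 0\<close>, where \<open>\<epsilon> / \<kappa> = 0\<close> and rounding to the grid makes no sense.\<close>

lemma zero_in_candidates: "0\<^sub>v n \<in> candidates n (Suc K) h"
proof -
  obtain u where u: "u \<in> multisets n (Suc K)" "increments n u = 0\<^sub>v n"
    using increments_surj[of "0\<^sub>v n" n K] by auto
  have "0\<^sub>v n \<in> SignPerm (support_vec n (0\<^sub>v n))"
    by (simp add: SignPerm_support_vec_iff)
  moreover have "0\<^sub>v n = grid_point n h (0\<^sub>v n) (0\<^sub>v n)" by (auto simp: grid_point_vec)
  ultimately have "0\<^sub>v n \<in> grid_point n h (increments n u) ` SignPerm (support_vec n (increments n u))"
    unfolding u(2) by (rule rev_image_eqI)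
  with u(1) show ?thesis unfolding candidates_def by (rule UN_I)
qed

text \<open>The nearby point is obtained by rounding each coordinate of \<open>x\<close> towards zero.  Rounding to the
  nearest multiple of \<open>h\<close> would be more accurate but could increase the 1-norm.\<close>

lemma candidate_near:
  assumes x: "x \<in> carrier_vec n" and "n \<ge> 1" and h: "h > 0" and K: "l1_norm x / h < real K + 1"
  shows "\<exists>y\<in>candidates n (Suc K) h. linf_norm (y - x) \<le> h"
proof -
  define v where "v = vec n (\<lambda>i. nat \<lfloor>\<bar>x $ i\<bar> / h\<rfloor>)"
  define s :: "int vec" where
    "s = vec n (\<lambda>i. if v $ i = 0 then 0 else if x $ i < 0 then - 1 else 1)"
  have v: "real (v $ i) = of_int \<lfloor>\<bar>x $ i\<bar> / h\<rfloor>" if "i < n" for i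
    using that h by (simp add: v_def)
  \<comment> \<open>The entry sum is an integer below \<open>K + 1\<close>, hence at most \<open>K\<close>.\<close>
  have "real (\<Sum>i<n. v $ i) = (\<Sum>i<n. real (v $ i))" by simp
  also have "\<dots> \<le> (\<Sum>i<n. \<bar>x $ i\<bar> / h)" by (intro sum_mono) (simp add: v)
  also have "\<dots> = l1_norm x / h" using x by (simp add: l1_norm_def sum_divide_distrib)
  finally have "(\<Sum>i<n. v $ i) \<le> K" using K by linarith
  then obtain u where u: "u \<in> multisets n (Suc K)" "increments n u = v"
    using increments_surj[of v n K] by (auto simp: v_def)
  have "s \<in> SignPerm (support_vec n v)" by (simp add: SignPerm_support_vec_iff s_def)
  then have cand: "grid_point n h v s \<in> candidates n (Suc K) h"
    using u unfolding candidates_def by blast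
  have "\<bar>(grid_point n h v s - x) $ i\<bar> \<le> h" if i: "i < n" for i
  proof -
    have "real (v $ i) \<le> \<bar>x $ i\<bar> / h" "\<bar>x $ i\<bar> / h < real (v $ i) + 1" unfolding v[OF i] by linarith+
    then have "h * real (v $ i) \<le> \<bar>x $ i\<bar>" "\<bar>x $ i\<bar> < h * real (v $ i) + h"
      using h by (simp_all add: field_simps)
    then show ?thesis using i x by (auto simp: grid_point_vec s_def)
  qed
  then have "linf_norm (grid_point n h v s - x) \<le> h"
    using x \<open>n \<ge> 1\<close> unfolding linf_norm_def by (subst Max_le_iff) (auto simp: lessThan_empty_iff)
  with cand show ?thesis by blast
qed

section \<open>Correctness\<close>

text \<open>The loop invariant: the state \<open>st\<close> is right when exactly the points in \<open>P\<close> have been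
  inspected.\<close>

definition best_of ::
    "(real vec \<Rightarrow> real) \<Rightarrow> (real vec \<Rightarrow> bool) \<Rightarrow> real vec set \<Rightarrow> real vec option \<times> ereal \<Rightarrow> bool" where
  "best_of f ok P st \<longleftrightarrow>
     (case fst st of
        None \<Rightarrow> snd st = \<infinity> \<and> (\<forall>x\<in>P. \<not> ok x)
      | Some x \<Rightarrow> snd st = ereal (f x) \<and> x \<in> P \<and> ok x \<and> (\<forall>y\<in>P. ok y \<longrightarrow> f x \<le> f y))"

lemma best_of_try_point:
  assumes "best_of f (\<lambda>x. g x \<le> const_vec m \<epsilon>) P st"
  shows "best_of f (\<lambda>x. g x \<le> const_vec m \<epsilon>) (P \<union> {x}) (fst (try_point_counted \<epsilon> n m f g x st))"
proof (cases "fst st")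
  case None
  then show ?thesis using assms by (auto simp: best_of_def try_point_counted_def)
next
  case (Some y)
  then have y: "snd st = ereal (f y)" "y \<in> P" "g y \<le> const_vec m \<epsilon>"
    and min: "\<And>z. z \<in> P \<Longrightarrow> g z \<le> const_vec m \<epsilon> \<Longrightarrow> f y \<le> f z"
    using assms by (auto simp: best_of_def)
  show ?thesis
  proof (cases "f x < f y \<and> g x \<le> const_vec m \<epsilon>")
    case True
    then show ?thesis using y(1) min
      by (simp add: best_of_def try_point_counted_def) (meson less_le_trans less_imp_le)
  next
    case False
    then show ?thesis using Some y min by (auto simp: best_of_def try_point_counted_def)
  qed
qed

lemma algorithm3_best_of_candidates:
  fixes enumM :: "nat \<Rightarrow> nat \<Rightarrow> nat vec list" and enumS :: "nat vec \<Rightarrow> int vec list"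
  assumes M: "\<And>k N. enumerates (enumM k N) (multisets k N)"
    and S: "\<And>b. set\<^sub>v b \<subseteq> {0, 1} \<Longrightarrow> enumerates (enumS b) (SignPerm b)"
  shows "\<exists>fstar. best_of f (\<lambda>x. g x \<le> const_vec m \<epsilon>)
    (candidates n (Suc (nat \<lfloor>lam * \<kappa> / \<epsilon>\<rfloor>)) (\<epsilon> / \<kappa>))
    (fst (algorithm3 enumM enumS c lam \<kappa> \<epsilon> n m f g), fstar)"
proof -
  let ?I = "best_of f (\<lambda>x. g x \<le> const_vec m \<epsilon>)"
  let ?N = "Suc (nat \<lfloor>lam * \<kappa> / \<epsilon>\<rfloor>)"
  define inner where "inner v s st = charge c () \<triangleright> (\<lambda>_. grid_point_counted n (\<epsilon> / \<kappa>) v s \<triangleright> (\<lambda>x.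
         try_point_counted \<epsilon> n m f g x st))" for v s st
  define outer where "outer u st = charge c () \<triangleright> (\<lambda>_. \<phi>_counted n u \<triangleright> (\<lambda>v.
       support_counted n v \<triangleright> (\<lambda>b. for_each (enumS b) (inner v) st)))" for u st
  have inner: "?I (P \<union> {grid_point n (\<epsilon> / \<kappa>) v s}) (fst (inner v s st))" if "?I P st" for P v s st
    using best_of_try_point[OF that] by (simp add: inner_def grid_point_def)
  have "?I (P \<union> grid_point n (\<epsilon> / \<kappa>) (increments n u) ` SignPerm (support_vec n (increments n u)))
      (fst (outer u st))" if "?I P st" for P u st
  proof -
    let ?v = "increments n u"
    have "?I (P \<union> (\<Union>s\<in>set (enumS (support_vec n ?v)). {grid_point n (\<epsilon> / \<kappa>) ?v s}))
      (fst (for_each (enumS (support_vec n ?v)) (inner ?v) st))"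
      using inner that by (rule for_each_invariant)
    moreover have "set (enumS (support_vec n ?v)) = SignPerm (support_vec n ?v)"
      using S[OF support_vec_binary] by (simp add: enumerates_def)
    ultimately show ?thesis by (simp add: outer_def increments_def support_vec_def UNION_singleton_eq_range)
  qed
  moreover have "?I {} (None, \<infinity>)" by (simp add: best_of_def)
  ultimately have "?I ({} \<union> (\<Union>u\<in>set (enumM n ?N). grid_point n (\<epsilon> / \<kappa>) (increments n u) `
      SignPerm (support_vec n (increments n u)))) (fst (for_each (enumM n ?N) outer (None, \<infinity>)))"
    by (rule for_each_invariant)
  moreover have "set (enumM n ?N) = multisets n ?N" using M by (simp add: enumerates_def)
  ultimately have "?I (candidates n ?N (\<epsilon> / \<kappa>)) (fst (for_each (enumM n ?N) outer (None, \<infinity>)))"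
    by (simp add: candidates_def)
  moreover have "fst (algorithm3 enumM enumS c lam \<kappa> \<epsilon> n m f g)
      = fst (fst (for_each (enumM n ?N) outer (None, \<infinity>)))"
    by (simp add: algorithm3_def outer_def[abs_def] inner_def[abs_def])
  ultimately show ?thesis by (metis prod.collapse)
qed

text \<open>The Lipschitz condition turns closeness to the minimizer into an error of at most \<open>\<epsilon>\<close> in the
  objective and in each constraint.\<close>

lemma good_candidate:
  assumes "lam \<ge> 0" "\<kappa> \<ge> 0" "\<epsilon> > 0"
    and P: "lipschitz_problem \<kappa> n m f g" and opt: "is_minimizer lam n m f g xstar"
  shows "\<exists>y\<in>candidates n (Suc (nat \<lfloor>lam * \<kappa> / \<epsilon>\<rfloor>)) (\<epsilon> / \<kappa>).
    f y \<le> f xstar + \<epsilon> \<and> g y \<le> const_vec m \<epsilon>"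
proof -
  let ?K = "nat \<lfloor>lam * \<kappa> / \<epsilon>\<rfloor>"
  have x: "xstar \<in> carrier_vec n" "l1_norm xstar \<le> lam" "g xstar \<le> 0\<^sub>v m"
    using opt by (auto simp: is_minimizer_def feasible_set_def)
  have n: "n \<ge> 1" using P by (simp add: lipschitz_problem_def)
  obtain y where y: "y \<in> candidates n (Suc ?K) (\<epsilon> / \<kappa>)" and near: "\<kappa> * linf_norm (y - xstar) \<le> \<epsilon>"
  proof (cases "\<kappa> = 0")
    case True
    with that[OF zero_in_candidates] \<open>\<epsilon> > 0\<close> show ?thesis by simp
  next
    case False
    with assms have h: "\<epsilon> / \<kappa> > 0" by simp
    have "l1_norm xstar / (\<epsilon> / \<kappa>) \<le> lam / (\<epsilon> / \<kappa>)" using x h by (intro divide_right_mono) auto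
    also have "\<dots> = lam * \<kappa> / \<epsilon>" by simp
    also have "\<dots> < real ?K + 1" by linarith
    finally obtain y where "y \<in> candidates n (Suc ?K) (\<epsilon> / \<kappa>)" "linf_norm (y - xstar) \<le> \<epsilon> / \<kappa>"
      using candidate_near[OF x(1) n h] by blast
    with that[of y] False \<open>\<kappa> \<ge> 0\<close> show ?thesis by (simp add: field_simps)
  qed
  have yc: "y \<in> carrier_vec n" using y candidates_dim by blast
  have lip: "\<bar>f y - f xstar\<bar> \<le> \<epsilon>" "\<And>i. i < m \<Longrightarrow> \<bar>g y $ i - g xstar $ i\<bar> \<le> \<epsilon>"
    using P yc x(1) near unfolding lipschitz_problem_def by (meson order_trans)+
  have dims: "g y \<in> carrier_vec m" using P yc by (auto simp: lipschitz_problem_def)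
  have "g y $ i \<le> \<epsilon>" if "i < m" for i
  proof -
    have "g xstar $ i \<le> 0" using x(3) that by (auto simp: less_eq_vec_def)
    with lip(2)[OF that] show ?thesis by linarith
  qed
  with dims have "g y \<le> const_vec m \<epsilon>" by (auto simp: less_eq_vec_def const_vec_def)
  with lip(1) y show ?thesis by (intro bexI[of _ y]) auto
qed

lemma algorithm3_correct:
  fixes enumM :: "nat \<Rightarrow> nat \<Rightarrow> nat vec list" and enumS :: "nat vec \<Rightarrow> int vec list"
  assumes nonneg: "lam \<ge> 0" "\<kappa> \<ge> 0" and \<epsilon>: "\<epsilon> > 0"
    and M: "\<And>k N. enumerates (enumM k N) (multisets k N)"
    and S: "\<And>b. set\<^sub>v b \<subseteq> {0, 1} \<Longrightarrow> enumerates (enumS b) (SignPerm b)"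
    and P: "lipschitz_problem \<kappa> n m f g" and opt: "is_minimizer lam n m f g xstar"
  shows "\<exists>xhat. fst (algorithm3 enumM enumS c lam \<kappa> \<epsilon> n m f g) = Some xhat \<and>
    f xhat - f xstar \<le> \<epsilon> \<and> g xhat \<le> const_vec m \<epsilon> \<and> l1_norm xhat \<le> lam \<and> xhat \<in> carrier_vec n"
proof -
  let ?K = "nat \<lfloor>lam * \<kappa> / \<epsilon>\<rfloor>"
  let ?C = "candidates n (Suc ?K) (\<epsilon> / \<kappa>)"
  let ?r = "fst (algorithm3 enumM enumS c lam \<kappa> \<epsilon> n m f g)"
  obtain y where y: "y \<in> ?C" "f y \<le> f xstar + \<epsilon>" "g y \<le> const_vec m \<epsilon>"
    using good_candidate[OF nonneg \<epsilon> P opt] by blast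
  obtain fstar where best: "best_of f (\<lambda>x. g x \<le> const_vec m \<epsilon>) ?C (?r, fstar)"
    using algorithm3_best_of_candidates[OF M S] by blast
  then obtain xhat where r: "?r = Some xhat"
    using y by (cases ?r) (auto simp: best_of_def)
  with best y have xhat: "xhat \<in> ?C" "g xhat \<le> const_vec m \<epsilon>" "f xhat \<le> f y"
    by (auto simp: best_of_def)
  have "l1_norm xhat \<le> \<epsilon> / \<kappa> * real ?K"
    using l1_norm_candidate_le[OF xhat(1)] nonneg \<epsilon> by simp
  also have "\<dots> \<le> \<epsilon> / \<kappa> * (lam * \<kappa> / \<epsilon>)"
    using nonneg \<epsilon> by (intro mult_left_mono) (auto intro: of_nat_floor)
  also have "\<dots> \<le> lam" using nonneg \<epsilon> by simp
  finally show ?thesis using r xhat y(2) candidates_dim by force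
qed

section \<open>Running time\<close>

text \<open>The constant 6 pays for the initial charges.  For each of the at most \<open>(n + 1)\<^sup>K\<close> vectors \<open>u\<close>,
  \<open>c + 2 n\<close> steps generate it and compute the differences and their support; for each of its at most
  \<open>2\<^sup>K\<close> sign patterns, \<open>c + 2 n\<close> steps produce the grid point and at most \<open>n + 3\<close> test and store it.\<close>

definition time_poly :: "nat \<Rightarrow> nat \<Rightarrow> nat poly" where
  "time_poly c K = [:6:] + [:1, 1:] ^ K * ([:c, 2:] + [:2 ^ K:] * [:c + 3, 3:])"

lemma poly_time_poly:
  "poly (time_poly c K) n = 6 + (n + 1) ^ K * (c + 2 * n + 2 ^ K * (c + 3 + 3 * n))"
  by (simp add: time_poly_def algebra_simps)

lemma algorithm3_time:
  fixes enumM :: "nat \<Rightarrow> nat \<Rightarrow> nat vec list" and enumS :: "nat vec \<Rightarrow> int vec list"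
  assumes M: "\<And>k N. enumerates (enumM k N) (multisets k N)"
    and S: "\<And>b. set\<^sub>v b \<subseteq> {0, 1} \<Longrightarrow> enumerates (enumS b) (SignPerm b)"
  shows "snd (algorithm3 enumM enumS c lam \<kappa> \<epsilon> n m f g)
    \<le> poly (time_poly c (nat \<lfloor>lam * \<kappa> / \<epsilon>\<rfloor>)) n"
proof -
  let ?K = "nat \<lfloor>lam * \<kappa> / \<epsilon>\<rfloor>"
  define inner where "inner v s st = charge c () \<triangleright> (\<lambda>_. grid_point_counted n (\<epsilon> / \<kappa>) v s \<triangleright> (\<lambda>x.
         try_point_counted \<epsilon> n m f g x st))" for v s st
  define outer where "outer u st = charge c () \<triangleright> (\<lambda>_. \<phi>_counted n u \<triangleright> (\<lambda>v.
       support_counted n v \<triangleright> (\<lambda>b. for_each (enumS b) (inner v) st)))" for u st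
  have inner: "snd (inner v s st) \<le> c + 3 + 3 * n" for v s st
    by (simp add: inner_def grid_point_counted_def build_vec_def try_point_counted_def)
  have outer: "snd (outer u st) \<le> c + 2 * n + 2 ^ ?K * (c + 3 + 3 * n)"
    if "u \<in> set (enumM n (Suc ?K))" for u st
  proof -
    let ?v = "increments n u" and ?b = "support_vec n (increments n u)"
    have u: "u \<in> multisets n (Suc ?K)" using M that by (auto simp: enumerates_def)
    have "snd (for_each (enumS ?b) (inner ?v) st) \<le> length (enumS ?b) * (c + 3 + 3 * n)"
      using inner by (rule snd_for_each_le)
    also have "length (enumS ?b) = card (SignPerm ?b)"
      using S[OF support_vec_binary] by (auto simp: enumerates_def distinct_card[symmetric])
    also have "\<dots> * (c + 3 + 3 * n) \<le> 2 ^ ?K * (c + 3 + 3 * n)"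
      using card_SignPerm_le[OF sum_increments_le[OF u]] by (rule mult_le_mono1)
    finally have "snd (for_each (enumS ?b) (inner ?v) st) \<le> 2 ^ ?K * (c + 3 + 3 * n)" .
    moreover have "snd (\<phi>_counted n u) = n" "snd (support_counted n ?v) = n"
      by (simp_all add: \<phi>_counted_def support_counted_def build_vec_def)
    ultimately show ?thesis by (simp add: outer_def increments_def support_vec_def)
  qed
  have "snd (for_each (enumM n (Suc ?K)) outer (None, \<infinity>))
      \<le> length (enumM n (Suc ?K)) * (c + 2 * n + 2 ^ ?K * (c + 3 + 3 * n))"
    using outer by (rule snd_for_each_le)
  also have "length (enumM n (Suc ?K)) = card (multisets n (Suc ?K))"
    using M by (metis enumerates_def distinct_card)
  also have "\<dots> * (c + 2 * n + 2 ^ ?K * (c + 3 + 3 * n))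
      \<le> (n + 1) ^ ?K * (c + 2 * n + 2 ^ ?K * (c + 3 + 3 * n))"
    using card_multisets_le by (rule mult_le_mono1)
  finally have "snd (for_each (enumM n (Suc ?K)) outer (None, \<infinity>)) + 6 \<le> poly (time_poly c ?K) n"
    unfolding poly_time_poly by simp
  moreover have "snd (algorithm3 enumM enumS c lam \<kappa> \<epsilon> n m f g)
      = snd (for_each (enumM n (Suc ?K)) outer (None, \<infinity>)) + 6"
    by (simp add: algorithm3_def outer_def[abs_def] inner_def[abs_def])
  ultimately show ?thesis by simp
qed

lemma time_poly_le:
  assumes "n \<ge> 1"
  shows "poly (time_poly c K) n \<le> (6 + 2 ^ K * (c + 2 + 2 ^ K * (c + 6))) * n ^ (K + 1)"
proof -
  have "6 \<le> 6 * n ^ (K + 1)" using assms by simp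
  moreover have "(n + 1) ^ K \<le> 2 ^ K * n ^ K"
    using assms unfolding power_mult_distrib[symmetric] by (intro power_mono) auto
  moreover have "c + 2 * n + 2 ^ K * (c + 3 + 3 * n) \<le> (c + 2 + 2 ^ K * (c + 6)) * n"
  proof -
    have "c \<le> c * n" "c + 3 + 3 * n \<le> (c + 6) * n"
      using assms by (simp_all add: algebra_simps add_mono)
    then have "c + 2 * n + 2 ^ K * (c + 3 + 3 * n) \<le> c * n + 2 * n + 2 ^ K * ((c + 6) * n)"
      by (intro add_mono mult_le_mono) auto
    then show ?thesis by (simp add: algebra_simps)
  qed
  ultimately have "poly (time_poly c K) n
    \<le> 6 * n ^ (K + 1) + (2 ^ K * n ^ K) * ((c + 2 + 2 ^ K * (c + 6)) * n)"
    unfolding poly_time_poly by (intro add_mono mult_le_mono)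
  also have "\<dots> = (6 + 2 ^ K * (c + 2 + 2 ^ K * (c + 6))) * n ^ (K + 1)"
    by (simp add: algebra_simps)
  finally show ?thesis .
qed

lemma time_poly_bigo:
  assumes "real K + 1 \<le> e"
  shows "(\<lambda>n. real (poly (time_poly c K) n)) \<in> O(\<lambda>n. real n powr e)"
proof (rule bigoI, rule eventually_sequentiallyI)
  fix n :: nat assume n: "n \<ge> 1"
  let ?C = "6 + 2 ^ K * (c + 2 + 2 ^ K * (c + 6))"
  have "real (poly (time_poly c K) n) \<le> real (?C * n ^ (K + 1))"
    using time_poly_le[OF n] of_nat_mono by blast
  also have "\<dots> = real ?C * real n powr (real K + 1)"
    using n powr_realpow[of "real n" "K + 1"] by (simp add: add.commute)
  also have "\<dots> \<le> real ?C * real n powr e"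
    using n assms by (intro mult_left_mono powr_mono) auto
  finally show "norm (real (poly (time_poly c K) n)) \<le> real ?C * norm (real n powr e)"
    by simp
qed

text \<open>The point is \<open>k \<le> 2 k\<^sup>2\<close>, which fails for small positive \<open>k\<close>; hence the gap between 0 and 1.\<close>

lemma exponent_le:
  fixes k \<delta> :: real
  assumes "k = 0 \<or> k \<ge> 1" and "\<delta> \<ge> 0"
  shows "k + 1 \<le> ((2 + \<delta>) * k)\<^sup>2 / 2 + 1"
proof (cases "k = 0")
  case False
  then have k: "k \<ge> 1" using assms by simp
  have "k \<le> 2 * (k * k)" using k mult_left_mono[of 1 k k] by simp
  also have "2 * (k * k) = (2 * k)\<^sup>2 / 2" by (simp add: power2_eq_square)
  also have "(2 * k)\<^sup>2 \<le> ((2 + \<delta>) * k)\<^sup>2"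
    using k assms by (intro power_mono mult_right_mono) auto
  finally show ?thesis by (simp add: divide_right_mono)
qed simp

theorem theorem4:
  fixes lam \<kappa> :: real and c :: nat
    and enumM :: "nat \<Rightarrow> nat \<Rightarrow> nat vec list" and enumS :: "nat vec \<Rightarrow> int vec list"
  assumes "lam \<ge> 0" and "\<kappa> \<ge> 0"
    and "\<And>k N. enumerates (enumM k N) (multisets k N)"
    and "\<And>b. set\<^sub>v b \<subseteq> {0, 1} \<Longrightarrow> enumerates (enumS b) (SignPerm b)"
  shows "additive_PTAS lam \<kappa> (algorithm3 enumM enumS c lam \<kappa>) \<and>
    (\<forall>\<epsilon>>0. \<forall>\<delta>\<in>{0<..<1}.
       oracle_time_bigo lam \<kappa> (algorithm3 enumM enumS c lam \<kappa>) \<epsilon>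
         (\<lambda>n. real n powr (((2 + \<delta>) * real_of_int \<lfloor>lam * \<kappa> / \<epsilon>\<rfloor>)\<^sup>2 / 2 + 1)))"
proof (intro conjI allI impI ballI)
  note correct = algorithm3_correct[OF assms(1,2) _ assms(3,4)]
  have time: "snd (algorithm3 enumM enumS c lam \<kappa> \<epsilon> n m f g)
      \<le> poly (time_poly c (nat \<lfloor>lam * \<kappa> / \<epsilon>\<rfloor>)) n" for \<epsilon> n m f g
    using assms(3,4) by (rule algorithm3_time)
  show "additive_PTAS lam \<kappa> (algorithm3 enumM enumS c lam \<kappa>)"
    unfolding additive_PTAS_def using correct time by blast
  fix \<epsilon> \<delta> :: real
  assume \<epsilon>: "\<epsilon> > 0" and \<delta>: "\<delta> \<in> {0<..<1}"
  let ?k = "\<lfloor>lam * \<kappa> / \<epsilon>\<rfloor>"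
  let ?e = "((2 + \<delta>) * real_of_int ?k)\<^sup>2 / 2 + 1"
  have k: "?k \<ge> 0" using assms(1,2) \<epsilon> by simp
  have "real_of_int ?k + 1 \<le> ?e"
  proof (rule exponent_le)
    have "?k = 0 \<or> ?k \<ge> 1" using k by linarith
    then show "real_of_int ?k = 0 \<or> real_of_int ?k \<ge> 1"
      unfolding of_int_eq_0_iff of_int_1_le_iff .
  qed (use \<delta> in simp)
  with k have "real (nat ?k) + 1 \<le> ?e" by simp
  then have "(\<lambda>n. real (poly (time_poly c (nat ?k)) n)) \<in> O(\<lambda>n. real n powr ?e)"
    by (rule time_poly_bigo)
  with time show "oracle_time_bigo lam \<kappa> (algorithm3 enumM enumS c lam \<kappa>) \<epsilon> (\<lambda>n. real n powr ?e)"
    unfolding oracle_time_bigo_def by (intro exI[of _ "poly (time_poly c (nat ?k))"]) simp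
qed

end
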